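(* Let $d,l$ be integers with $1\leqslant d\leqslant l$, and let $f:\mathbb{N}\to\mathbb{R}$ be a function of the form $$f(n)=c_{l}n^{l}+c_{l-1}n^{l-1}+\cdots+c_{l-d}n^{l-d}+o(n^{l-d})\qquad (n\to\infty),$$ where $c_l,c_{l-1},\ldots,c_{l-d}$ are real constants (independent of $n$) and $c_l\neq 0$. Then, for every integer $1\leqslant j\leqslant d$, the sequence $(f(n))_{n=0}^\infty$ satisfies the order $j$ Turán inequality at $n$ for all but finitely many values of $n\in\mathbb{N}$.
   Context: $\mathbb{N}$ denotes the set of non-negative integers. For a sequence $\omega=(\omega_i)_{i=0}^\infty$ of real numbers, the Jensen polynomial of degree $d$ and shift $n$ associated to $\omega$ is $$J_\omega^{d,n}(x):=\sum_{i=0}^d\binom{d}{i}\omega_{n+i}x^i.$$ A polynomial with real coefficients is called hyperbolic if all of its (complex) roots are real. The sequence $\omega$ satisfies the order $d$ Turán inequality at $n$ if and only if $J_\omega^{d,n}(x)$ is hyperbolic. *)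

theory Defs
  imports
    "HOL-Analysis.Analysis"
    "HOL-Computational_Algebra.Polynomial"
    "HOL-Library.Landau_Symbols"
begin

definition jensen_poly :: "(nat \<Rightarrow> real) \<Rightarrow> nat \<Rightarrow> nat \<Rightarrow> real poly" where
  "jensen_poly \<omega> d n = (\<Sum>i\<le>d. monom (real (d choose i) * \<omega> (n + i)) i)"

text \<open>
  The condition is on the roots of the complexified polynomial. Nonzero constants
  are hyperbolic (they have no roots); the zero polynomial is not.
\<close>

definition hyperbolic :: "real poly \<Rightarrow> bool" where
  "hyperbolic p \<longleftrightarrow> (\<forall>z::complex. poly (map_poly complex_of_real p) z = 0 \<longrightarrow> z \<in> \<real>)"

definition turan_ineq :: "(nat \<Rightarrow> real) \<Rightarrow> nat \<Rightarrow> nat \<Rightarrow> bool" where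
  "turan_ineq \<omega> d n \<longleftrightarrow> hyperbolic (jensen_poly \<omega> d n)"

end

theory Submission
  imports Defs "HOL-Real_Asymp.Real_Asymp"
begin

text \<open>
  Write \<open>\<Delta>\<close> for the forward difference operator. Expanding \<open>f (n + i)\<close> by Newton's formula turns
  the Jensen polynomial into
  \<open>J(x) = (\<Sum>k\<le>j. binom(j,k) (\<Delta>^k f)(n) x^k (1+x)^(j-k))\<close> (\<open>jensen_poly_fdiff\<close>).
  The assumed expansion of \<open>f\<close> is exact enough to be differenced up to \<open>d\<close> times: the polynomial part
  gives \<open>(\<Delta>^k f)(n) ~ c_l l!/(l-k)! n^(l-k)\<close> for \<open>k \<le> d\<close>, while \<open>\<Delta>^k\<close> keeps the error inside
  \<open>o(n^(l-d))\<close>, which is negligible (\<open>funpow_fdiff_tendsto\<close>).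

  Substituting \<open>x = n/(y-n)\<close>, so that \<open>1+x = y/(y-n)\<close>, all the powers of \<open>n\<close> are absorbed: up to the
  nonzero factor \<open>n^l (y-n)^(-j)\<close>, the value of \<open>J\<close> is a polynomial \<open>F n\<close> in \<open>y\<close> that converges to
  \<open>c_l R(y)\<close> with \<open>R(y) = (\<Sum>k\<le>j. binom(j,k) l!/(l-k)! y^(j-k))\<close>, a Laguerre polynomial in \<open>-y\<close>
  (\<open>jensen_poly_rescaled\<close>).

  Now \<open>y^(l-j) R(y) = (1 + d/dy)^j y^l\<close>, and \<open>e^y (g + g') = (e^y g)'\<close>. Rolle's theorem for \<open>e^y g\<close>,
  applied also between \<open>-\<infinity>\<close>, where \<open>e^y g\<close> vanishes, and the smallest root, therefore yields by
  induction \<open>j\<close> distinct negative roots of \<open>R\<close> (\<open>laguerre_reflected_roots\<close>). Since \<open>R\<close> has degree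
  \<open>j\<close>, they are simple, so \<open>R\<close> changes sign at each of them, and by the intermediate value theorem
  \<open>F n\<close> has \<open>j\<close> distinct negative roots for all large \<open>n\<close> (\<open>eventually_many_negative_roots\<close>).
  As \<open>y \<mapsto> n/(y-n)\<close> is injective, \<open>J\<close> has \<open>j\<close> distinct real roots. It is not the zero polynomial, as
  \<open>J(0) = f(n) \<noteq> 0\<close>, and has degree at most \<open>j\<close>, so there are no further complex roots.
\<close>

section \<open>Rolle's theorem for the operator \<open>1 + d/dy\<close>\<close>

lemma tendsto_exp_mult_poly_at_bot:
  fixes p :: "real poly"
  shows "((\<lambda>y. exp y * poly p y) \<longlongrightarrow> 0) at_bot"
proof -
  have mono: "((\<lambda>y::real. exp y * y ^ k) \<longlongrightarrow> 0) at_bot" for k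
  proof -
    have "((\<lambda>y::real. (-1) ^ k * (y ^ k / exp y)) \<longlongrightarrow> (-1) ^ k * 0) at_top"
      by (intro tendsto_mult tendsto_const tendsto_power_div_exp_0)
    moreover have "(-1) ^ k * (y ^ k / exp y) = exp (- y) * (- y) ^ k" for y :: real
      by (simp add: exp_minus divide_inverse power_minus[of y])
    ultimately show ?thesis
      unfolding filterlim_at_bot_mirror by simp
  qed
  have "((\<lambda>y. \<Sum>i\<le>degree p. coeff p i * (exp y * y ^ i)) \<longlongrightarrow>
      (\<Sum>i\<le>degree p. coeff p i * 0)) at_bot"
    by (intro tendsto_sum tendsto_mult tendsto_const mono)
  moreover have "(\<Sum>i\<le>degree p. coeff p i * (exp y * y ^ i)) = exp y * poly p y" for y
    unfolding poly_altdef sum_distrib_left by (intro sum.cong) simp_all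
  ultimately show ?thesis by simp
qed

lemma has_real_derivative_exp_mult_poly:
  fixes p :: "real poly"
  shows "((\<lambda>y. exp y * poly p y) has_real_derivative exp y * poly (p + pderiv p) y) (at y)"
  by (auto intro!: derivative_eq_intros simp: algebra_simps)

text \<open>The derivative of \<open>e^y p\<close> is \<open>e^y (p + p')\<close>, and the exponential factor creates no zeros.\<close>
lemma Rolle_poly_add_pderiv:
  fixes p :: "real poly"
  assumes "a < b" "poly p a = 0" "poly p b = 0"
  obtains z where "a < z" "z < b" "poly (p + pderiv p) z = 0"
proof -
  have "\<exists>z. a < z \<and> z < b \<and> ((\<lambda>y. exp y * poly p y) has_real_derivative 0) (at z)"
    using assms
    by (intro Rolle) (auto intro!: continuous_intros
        simp: real_differentiable_def intro: has_real_derivative_exp_mult_poly)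
  then obtain z where z: "a < z" "z < b"
      "((\<lambda>y. exp y * poly p y) has_real_derivative 0) (at z)" by blast
  with DERIV_unique[OF z(3) has_real_derivative_exp_mult_poly[of p z]]
  show ?thesis using that by simp
qed

text \<open>
  The left end point of Rolle's theorem may be \<open>-\<infinity>\<close> because \<open>h(y) = e^y p(y)\<close> tends to \<open>0\<close> there.
  If \<open>h y \<noteq> 0\<close> for some \<open>y < b\<close>, then \<open>h\<^sup>2\<close> is larger at \<open>y\<close> than at \<open>b\<close> and at some point \<open>m\<close> far to
  the left, so its maximum over \<open>[m, b]\<close> is interior.
\<close>
lemma Rolle_poly_add_pderiv_at_bot:
  fixes p :: "real poly"
  assumes "poly p b = 0"
  obtains z where "z < b" "poly (p + pderiv p) z = 0"
proof (cases "p = 0")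
  case True
  with that[of "b - 1"] show ?thesis by simp
next
  case False
  define h where "h = (\<lambda>y. exp y * poly p y)"
  have "\<not> {..<b} \<subseteq> {y. poly p y = 0}"
    using poly_roots_finite[OF False] infinite_Iio finite_subset by blast
  then obtain y where y: "y < b" "h y \<noteq> 0"
    by (auto simp: h_def)
  have "\<forall>\<^sub>F x in at_bot. \<bar>h x\<bar> < \<bar>h y\<bar>"
    using tendstoD[OF tendsto_exp_mult_poly_at_bot[of p], of "\<bar>h y\<bar>"] y
    by (simp add: h_def dist_real_def)
  then have "\<forall>\<^sub>F x in at_bot. \<bar>h x\<bar> < \<bar>h y\<bar> \<and> x < y"
    using eventually_gt_at_bot by (rule eventually_conj)
  then obtain m where m: "\<bar>h m\<bar> < \<bar>h y\<bar>" "m < y"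
    by (auto dest!: eventually_happens)
  have "continuous_on {m..b} (\<lambda>x. (h x)\<^sup>2)"
    by (auto intro!: continuous_intros simp: h_def)
  then obtain z where z: "z \<in> {m..b}" "\<And>x. x \<in> {m..b} \<Longrightarrow> (h x)\<^sup>2 \<le> (h z)\<^sup>2"
    using continuous_attains_sup[of "{m..b}" "\<lambda>x. (h x)\<^sup>2"] m y by force
  have hz: "\<bar>h y\<bar> \<le> \<bar>h z\<bar>"
    using z(2)[of y] m y by (simp add: abs_le_square_iff)
  have "h b = 0" using assms by (simp add: h_def)
  then have zi: "m < z" "z < b"
    using hz m y z(1) by (auto simp: less_le)
  have der: "((\<lambda>x. (h x)\<^sup>2) has_real_derivative
      2 * h z * (exp z * poly (p + pderiv p) z)) (at z)"
    using has_real_derivative_exp_mult_poly[of p z, folded h_def]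
    by (auto intro!: derivative_eq_intros)
  have "2 * h z * (exp z * poly (p + pderiv p) z) = 0"
  proof (rule DERIV_local_max[OF der])
    show "0 < min (z - m) (b - z)" using zi by simp
    show "\<forall>x. \<bar>z - x\<bar> < min (z - m) (b - z) \<longrightarrow> (h x)\<^sup>2 \<le> (h z)\<^sup>2"
    proof (intro allI impI z(2))
      fix x assume "\<bar>z - x\<bar> < min (z - m) (b - z)"
      then show "x \<in> {m..b}" unfolding atLeastAtMost_iff by arith
    qed
  qed
  moreover have "h z \<noteq> 0" using hz y by auto
  ultimately show ?thesis using that zi by simp
qed

text \<open>
  No root is lost: the \<open>card A - 1\<close> gaps between neighbouring elements of \<open>A\<close> and the unbounded gap to
  the left of \<open>A\<close> contribute one root each.
\<close>
lemma roots_poly_add_pderiv: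
  fixes p :: "real poly"
  assumes "finite A" "\<And>a. a \<in> A \<Longrightarrow> poly p a = 0" "\<And>a. a \<in> A \<Longrightarrow> a \<le> u"
  obtains B where "finite B" "card B = card A" "\<And>b. b \<in> B \<Longrightarrow> poly (p + pderiv p) b = 0"
    "\<And>b. b \<in> B \<Longrightarrow> b < u"
  using assms
proof (induction A arbitrary: u thesis rule: finite_linorder_max_induct)
  case empty
  then show ?case by (metis empty_iff finite.emptyI)
next
  case (insert a A)
  show ?case
  proof (cases "A = {}")
    case True
    obtain z where "z < a" "poly (p + pderiv p) z = 0"
      using Rolle_poly_add_pderiv_at_bot[of p a] insert.prems by auto
    moreover have "a \<le> u" using insert.prems by simp
    ultimately show ?thesis
      by (intro insert.prems(1)[of "{z}"]) (simp_all add: True)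
  next
    case False
    define m where "m = Max A"
    have m: "m \<in> A" "\<And>x. x \<in> A \<Longrightarrow> x \<le> m"
      using False insert.hyps by (auto simp: m_def)
    obtain B where B: "finite B" "card B = card A"
        "\<And>b. b \<in> B \<Longrightarrow> poly (p + pderiv p) b = 0" "\<And>b. b \<in> B \<Longrightarrow> b < m"
      using insert.IH[of m] insert.prems m by blast
    obtain z where z: "m < z" "z < a" "poly (p + pderiv p) z = 0"
      using Rolle_poly_add_pderiv[of m a p] insert.prems insert.hyps m by auto
    have "z \<notin> B" using B(4)[of z] z by auto
    have "a \<notin> A" using insert.hyps by auto
    have "a \<le> u" using insert.prems by simp
    show ?thesis
    proof (rule insert.prems(1)[of "insert z B"])
      show "card (insert z B) = card (insert a A)"
        using B insert.hyps \<open>z \<notin> B\<close> \<open>a \<notin> A\<close> by simp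
      show "b < u" if "b \<in> insert z B" for b
        using that B(4)[of b] z \<open>a \<le> u\<close> by auto
    qed (use B z in auto)
  qed
qed

section \<open>The limit polynomial\<close>

text \<open>
  Pascal's rule in the form of the induction step for binomial expansions. It serves both for the
  powers of \<open>1 + d/dy\<close> and for Newton's formula.
\<close>
lemma sum_choose_Suc:
  fixes a :: "nat \<Rightarrow> 'a::comm_semiring_1"
  shows "(\<Sum>k\<le>Suc j. of_nat (Suc j choose k) * a k) =
    (\<Sum>k\<le>j. of_nat (j choose k) * (a k + a (Suc k)))"
proof -
  have "(\<Sum>k\<le>Suc j. of_nat (Suc j choose k) * a k) =
      a 0 + (\<Sum>k\<le>j. of_nat (j choose Suc k) * a (Suc k)) + (\<Sum>k\<le>j. of_nat (j choose k) * a (Suc k))"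
    by (simp add: sum.atMost_Suc_shift algebra_simps sum.distrib del: sum.atMost_Suc)
  also have "a 0 + (\<Sum>k\<le>j. of_nat (j choose Suc k) * a (Suc k)) =
      (\<Sum>k\<le>Suc j. of_nat (j choose k) * a k)"
    by (simp add: sum.atMost_Suc_shift del: sum.atMost_Suc)
  also have "\<dots> = (\<Sum>k\<le>j. of_nat (j choose k) * a k)"
    by (simp add: binomial_eq_0[of j "Suc j"])
  finally show ?thesis
    by (simp add: algebra_simps sum.distrib)
qed

lemma funpow_add_pderiv:
  fixes q :: "'a::idom poly"
  shows "((\<lambda>g. g + pderiv g) ^^ j) q = (\<Sum>k\<le>j. of_nat (j choose k) * (pderiv ^^ k) q)"
proof (induction j)
  case (Suc j)
  have "pderiv (of_nat c * r) = of_nat c * pderiv r" for c and r :: "'a poly"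
    by (simp add: pderiv_mult)
  moreover have "pderiv (sum h A) = (\<Sum>x\<in>A. pderiv (h x))" for h :: "nat \<Rightarrow> 'a poly" and A
    using higher_pderiv_sum[of 1 h A] by simp
  ultimately have pd: "pderiv (\<Sum>k\<le>j. of_nat (j choose k) * (pderiv ^^ k) q) =
     (\<Sum>k\<le>j. of_nat (j choose k) * (pderiv ^^ Suc k) q)"
    by simp
  show ?case
    by (simp only: sum_choose_Suc funpow.simps(2) o_def Suc.IH pd distrib_left sum.distrib)
qed simp

lemma funpow_pderiv_monom:
  assumes "k \<le> l"
  shows "(pderiv ^^ k) (monom 1 l) = monom (fact l / fact (l - k) :: real) (l - k)"
  using assms
proof (induction k)
  case (Suc k)
  then have "l - k = Suc (l - Suc k)" by simp
  with Suc show ?case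
    by (simp add: pderiv_monom del: of_nat_Suc)
qed simp

text \<open>
  For \<open>j \<le> l\<close> this is \<open>j!\<close> times the generalized Laguerre polynomial of degree \<open>j\<close> with
  parameter \<open>l - j\<close>, evaluated at \<open>-y\<close>.
\<close>
definition laguerre_reflected :: "nat \<Rightarrow> nat \<Rightarrow> real poly" where
  "laguerre_reflected l j = (\<Sum>k\<le>j. monom (real (j choose k) * (fact l / fact (l - k))) (j - k))"

lemma poly_laguerre_reflected:
  "poly (laguerre_reflected l j) y = (\<Sum>k\<le>j. real (j choose k) * (fact l / fact (l - k)) * y ^ (j - k))"
  by (simp add: laguerre_reflected_def poly_sum poly_monom)

lemma degree_laguerre_reflected: "degree (laguerre_reflected l j) = j"
  and laguerre_reflected_nonzero: "laguerre_reflected l j \<noteq> 0"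
proof -
  have le: "degree (laguerre_reflected l j) \<le> j"
    unfolding laguerre_reflected_def
    by (intro degree_sum_le) (auto intro: order_trans[OF degree_monom_le])
  have "coeff (laguerre_reflected l j) j = (\<Sum>k\<le>j. if k = 0 then 1 else 0)"
    unfolding laguerre_reflected_def coeff_sum by (intro sum.cong) auto
  then have c: "coeff (laguerre_reflected l j) j \<noteq> 0"
    by simp
  then show "laguerre_reflected l j \<noteq> 0" by auto
  show "degree (laguerre_reflected l j) = j"
    using le le_degree[OF c] by (rule antisym)
qed

text \<open>
  This is Rodrigues' formula: \<open>(1 + d/dy)^j\<close> is \<open>(d/dy)^j\<close> conjugated by multiplication with \<open>e^y\<close>.
\<close>
lemma poly_funpow_add_pderiv_monom:
  assumes "j \<le> l"
  shows "poly (((\<lambda>g. g + pderiv g) ^^ j) (monom 1 l)) y = y ^ (l - j) * poly (laguerre_reflected l j) y"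
proof -
  have "poly (of_nat c * p) y = real c * poly p y" for c and p :: "real poly"
    by (simp)
  then have "poly (((\<lambda>g. g + pderiv g) ^^ j) (monom 1 l)) y =
      (\<Sum>k\<le>j. real (j choose k) * poly ((pderiv ^^ k) (monom 1 l)) y)"
    by (simp add: funpow_add_pderiv poly_sum)
  also have "\<dots> = (\<Sum>k\<le>j. y ^ (l - j) * (real (j choose k) * (fact l / fact (l - k)) * y ^ (j - k)))"
  proof (rule sum.cong)
    fix k assume "k \<in> {..j}"
    then have "k \<le> l" "l - k = (l - j) + (j - k)" using assms by auto
    then have "k \<le> l" "y ^ (l - k) = y ^ (l - j) * y ^ (j - k)"
      by (simp_all only: power_add)
    then show "real (j choose k) * poly ((pderiv ^^ k) (monom 1 l)) y =
        y ^ (l - j) * (real (j choose k) * (fact l / fact (l - k)) * y ^ (j - k))"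
      by (simp add: funpow_pderiv_monom poly_monom)
  qed simp
  finally show ?thesis by (simp add: poly_laguerre_reflected sum_distrib_left)
qed

text \<open>
  As long as \<open>j < l\<close>, the polynomial \<open>(1 + d/dy)^j y^l\<close> also vanishes at \<open>0\<close>. Including this zero
  among the \<open>j\<close> negative ones is what makes the number of negative roots grow by one in each step.
\<close>
lemma laguerre_reflected_roots:
  assumes "j \<le> l"
  obtains A where "finite A" "card A = j" "\<And>a. a \<in> A \<Longrightarrow> a < 0"
    "\<And>a. a \<in> A \<Longrightarrow> poly (laguerre_reflected l j) a = 0"
proof -
  define g where "g j = ((\<lambda>g. g + pderiv g) ^^ j) (monom (1::real) l)" for j
  have "\<exists>A. finite A \<and> card A = j \<and> (\<forall>a\<in>A. a < 0 \<and> poly (g j) a = 0)"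
    using assms
  proof (induction j)
    case 0
    then show ?case by (intro exI[of _ "{}"]) simp
  next
    case (Suc j)
    then obtain A where A: "finite A" "card A = j" "\<forall>a\<in>A. a < 0 \<and> poly (g j) a = 0"
      by auto
    have g0: "poly (g j) 0 = 0"
      using Suc.prems by (simp add: g_def poly_funpow_add_pderiv_monom)
    obtain B where "finite B" "card B = card (insert 0 A)"
        "\<And>b. b \<in> B \<Longrightarrow> poly (g j + pderiv (g j)) b = 0" "\<And>b. b \<in> B \<Longrightarrow> b < 0"
      by (rule roots_poly_add_pderiv[of "insert 0 A" "g j" 0]) (use A g0 in \<open>auto simp: less_imp_le\<close>)
    moreover have "g (Suc j) = g j + pderiv (g j)" by (simp add: g_def)
    ultimately show ?case using A by (intro exI[of _ B]) force
  qed
  then obtain A where "finite A" "card A = j" "\<forall>a\<in>A. a < 0 \<and> poly (g j) a = 0" by blast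
  then show ?thesis
    using assms by (intro that[of A]) (auto simp: g_def poly_funpow_add_pderiv_monom)
qed

section \<open>Counting and perturbing roots\<close>

text \<open>
  If \<open>a\<close> were a multiple root, all of \<open>A\<close>, including \<open>a\<close>, would consist of roots of the quotient
  \<open>p / (y - a)\<close>, whose degree is too small for that.
\<close>
lemma pderiv_nonzero_if_card_roots:
  fixes p :: "real poly"
  assumes "p \<noteq> 0" "finite A" "card A = degree p" "\<And>a. a \<in> A \<Longrightarrow> poly p a = 0" "a \<in> A"
  shows "poly (pderiv p) a \<noteq> 0"
proof
  assume d0: "poly (pderiv p) a = 0"
  obtain q where q: "p = [:-a, 1:] * q"
    using assms by (metis poly_eq_0_iff_dvd dvdE)
  have q0: "q \<noteq> 0" using assms(1) q by auto
  have "pderiv p = q + [:-a, 1:] * pderiv q"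
    unfolding q pderiv_mult by (simp add: pderiv_pCons one_pCons)
  then have "poly q a = 0" using d0 by simp
  then have "A \<subseteq> {x. poly q x = 0}"
    using assms(4) by (force simp: q)
  then have "card A \<le> degree q"
    using card_poly_roots_bound[OF q0] card_mono[OF poly_roots_finite[OF q0]] order_trans by blast
  moreover have "degree p = Suc (degree q)"
    unfolding q using q0 by (subst degree_mult_eq) auto
  ultimately show False using assms(3) by simp
qed

lemma hyperbolicI_card_roots:
  assumes "p \<noteq> 0" "finite A" "degree p \<le> card A" "\<And>a. a \<in> A \<Longrightarrow> poly p a = 0"
  shows "hyperbolic p"
proof -
  let ?q = "map_poly complex_of_real p"
  have q: "?q \<noteq> 0" "degree ?q = degree p"
    using assms(1) by (auto simp: map_poly_eq_0_iff degree_map_poly)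
  have "poly ?q (complex_of_real a) = complex_of_real (poly p a)" for a
    by (induction p) (auto simp: map_poly_pCons)
  then have sub: "complex_of_real ` A \<subseteq> {z. poly ?q z = 0}"
    using assms(4) by auto
  have "card {z. poly ?q z = 0} \<le> card (complex_of_real ` A)"
    using card_poly_roots_bound[OF q(1)] q(2) assms(3)
    by (simp add: card_image inj_on_def)
  then have "complex_of_real ` A = {z. poly ?q z = 0}"
    by (rule card_seteq[OF poly_roots_finite[OF q(1)] sub])
  moreover have "complex_of_real ` A \<subseteq> \<real>" by auto
  ultimately have "{z. poly ?q z = 0} \<subseteq> \<real>" by simp
  then show ?thesis
    unfolding hyperbolic_def by blast
qed

text \<open>
  At a simple root \<open>p\<close> takes opposite signs at two points \<open>s < t\<close> on either side. Pointwise convergence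
  at just these two points transfers the sign change to \<open>F n\<close>.
\<close>
lemma eventually_root_near_simple_root:
  fixes p :: "real poly" and F :: "nat \<Rightarrow> real \<Rightarrow> real"
  assumes lim: "\<And>y. (\<lambda>n. F n y) \<longlonglongrightarrow> poly p y"
    and cont: "\<And>n. continuous_on UNIV (F n)"
    and root: "poly p a = 0" "poly (pderiv p) a \<noteq> 0" and "0 < \<delta>"
  shows "\<forall>\<^sub>F n in sequentially. \<exists>z. F n z = 0 \<and> \<bar>z - a\<bar> < \<delta>"
proof -
  obtain s t where st: "a - \<delta> < s" "s < t" "t < a + \<delta>" "poly p s * poly p t < 0"
  proof -
    consider "poly (pderiv p) a > 0" | "poly (pderiv p) a < 0" using root by linarith
    then obtain e where e: "0 < e" "\<And>h. 0 < h \<Longrightarrow> h < e \<Longrightarrow> poly p (a - h) * poly p (a + h) < 0"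
    proof cases
      case 1
      from DERIV_pos_inc_left[OF poly_DERIV 1] DERIV_pos_inc_right[OF poly_DERIV 1]
      obtain d1 d2 where "0 < d1" "0 < d2" "\<And>h. 0 < h \<Longrightarrow> h < d1 \<Longrightarrow> poly p (a - h) < 0"
        "\<And>h. 0 < h \<Longrightarrow> h < d2 \<Longrightarrow> 0 < poly p (a + h)"
        using root by auto
      then show ?thesis by (intro that[of "min d1 d2"]) (auto simp: mult_less_0_iff)
    next
      case 2
      from DERIV_neg_dec_left[OF poly_DERIV 2] DERIV_neg_dec_right[OF poly_DERIV 2]
      obtain d1 d2 where "0 < d1" "0 < d2" "\<And>h. 0 < h \<Longrightarrow> h < d1 \<Longrightarrow> 0 < poly p (a - h)"
        "\<And>h. 0 < h \<Longrightarrow> h < d2 \<Longrightarrow> poly p (a + h) < 0"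
        using root by auto
      then show ?thesis by (intro that[of "min d1 d2"]) (auto simp: mult_less_0_iff)
    qed
    obtain h where "0 < h" "h < e" "h < \<delta>"
      using field_lbound_gt_zero[OF \<open>0 < e\<close> \<open>0 < \<delta>\<close>] by auto
    then show ?thesis using e by (intro that[of "a - h" "a + h"]) auto
  qed
  have "(\<lambda>n. F n s * F n t) \<longlonglongrightarrow> poly p s * poly p t"
    by (intro tendsto_mult lim)
  then have "\<forall>\<^sub>F n in sequentially. F n s * F n t < 0"
    using st(4) by (rule order_tendstoD)
  then show ?thesis
  proof eventually_elim
    case (elim n)
    have c: "continuous_on {s..t} (F n)" using cont continuous_on_subset by blast
    from elim obtain z where "s \<le> z" "z \<le> t" "F n z = 0"
      using IVT'[of "F n" s 0 t] IVT2'[of "F n" t 0 s] c st(2)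
      by (fastforce simp: mult_less_0_iff)
    then show ?case using st by (intro exI[of _ z]) (auto simp: abs_less_iff)
  qed
qed

text \<open>
  A common radius \<open>\<delta>\<close> below the distance of each root to \<open>0\<close>, and below half of the distance between
  any two of them, keeps the perturbed roots negative and distinct.
\<close>
lemma eventually_many_negative_roots:
  fixes p :: "real poly" and F :: "nat \<Rightarrow> real \<Rightarrow> real"
  assumes lim: "\<And>y. (\<lambda>n. F n y) \<longlonglongrightarrow> poly p y"
    and cont: "\<And>n. continuous_on UNIV (F n)"
    and A: "finite A" "\<And>a. a \<in> A \<Longrightarrow> a < 0 \<and> poly p a = 0 \<and> poly (pderiv p) a \<noteq> 0"
  shows "\<forall>\<^sub>F n in sequentially. \<exists>B. finite B \<and> card B = card A \<and> (\<forall>b\<in>B. b < 0 \<and> F n b = 0)"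
proof -
  have ev: "\<forall>\<^sub>F \<delta> in at_right (0::real). \<delta> < c" if "c > 0" for c
    using that eventually_at_right by blast
  have sep: "\<forall>\<^sub>F \<delta> in at_right (0::real). \<delta> < - a \<and> (\<forall>b\<in>A. a \<noteq> b \<longrightarrow> \<delta> < \<bar>a - b\<bar> / 2)" if "a \<in> A" for a
  proof (intro eventually_conj eventually_ball_finite ballI)
    show "\<forall>\<^sub>F \<delta> in at_right 0. a \<noteq> b \<longrightarrow> \<delta> < \<bar>a - b\<bar> / 2" for b
      using ev[of "\<bar>a - b\<bar> / 2"] by (cases "a = b") auto
  qed (use A that in \<open>auto intro!: ev\<close>)
  have "\<forall>\<^sub>F \<delta> in at_right (0::real). 0 < \<delta> \<and>
      (\<forall>a\<in>A. \<delta> < - a \<and> (\<forall>b\<in>A. a \<noteq> b \<longrightarrow> \<delta> < \<bar>a - b\<bar> / 2))"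
    by (rule eventually_conj[OF eventually_at_right_less
          eventually_ball_finite[OF A(1) ballI[OF sep]]])
  then obtain \<delta> where \<delta>: "0 < \<delta>" "\<And>a. a \<in> A \<Longrightarrow> \<delta> < - a"
      "\<And>a b. a \<in> A \<Longrightarrow> b \<in> A \<Longrightarrow> a \<noteq> b \<Longrightarrow> \<delta> < \<bar>a - b\<bar> / 2"
    by (auto dest!: eventually_happens)
  have "\<forall>\<^sub>F n in sequentially. \<forall>a\<in>A. \<exists>z. F n z = 0 \<and> \<bar>z - a\<bar> < \<delta>"
    using A \<delta>(1) by (intro eventually_ball_finite ballI eventually_root_near_simple_root[OF lim cont]) auto
  then show ?thesis
  proof eventually_elim
    case (elim n)
    then obtain r where r: "\<And>a. a \<in> A \<Longrightarrow> F n (r a) = 0" "\<And>a. a \<in> A \<Longrightarrow> \<bar>r a - a\<bar> < \<delta>"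
      by metis
    have "inj_on r A"
      using r(2) \<delta>(3) unfolding inj_on_def by (smt (verit) field_sum_of_halves)
    moreover have "r a < 0" if "a \<in> A" for a
      using r(2)[OF that] \<delta>(2)[OF that] by linarith
    ultimately show ?case
      using A r(1) by (intro exI[of _ "r ` A"]) (auto simp: card_image)
  qed
qed

section \<open>Jensen polynomials and forward differences\<close>
definition fdiff :: "(nat \<Rightarrow> real) \<Rightarrow> nat \<Rightarrow> real" where
  "fdiff f n = f (Suc n) - f n"

lemma poly_jensen_poly:
  "poly (jensen_poly f j n) x = (\<Sum>i\<le>j. real (j choose i) * (f (n + i) * x ^ i))"
  by (simp add: jensen_poly_def poly_sum poly_monom mult.assoc)

text \<open>
  Umbrally, \<open>J = (1 + x E)^j f\<close> with the shift \<open>E = 1 + \<Delta>\<close>, and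
  \<open>1 + x E = (1 + x) + x \<Delta>\<close> can be expanded by the binomial theorem instead.
\<close>
lemma jensen_poly_fdiff:
  "poly (jensen_poly f j n) x =
    (\<Sum>k\<le>j. real (j choose k) * ((fdiff ^^ k) f n * x ^ k * (1 + x) ^ (j - k)))"
proof (induction j arbitrary: f)
  case 0
  then show ?case by (simp add: poly_jensen_poly)
next
  case (Suc j)
  have "poly (jensen_poly f (Suc j) n) x =
      (\<Sum>i\<le>j. real (j choose i) * (f (n + i) * x ^ i + f (n + Suc i) * x ^ Suc i))"
    unfolding poly_jensen_poly by (rule sum_choose_Suc)
  also have "\<dots> = (1 + x) * poly (jensen_poly f j n) x + x * poly (jensen_poly (fdiff f) j n) x"
    unfolding poly_jensen_poly sum_distrib_left sum.distrib[symmetric]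
    by (intro sum.cong) (auto simp: fdiff_def algebra_simps)
  also have "\<dots> = (\<Sum>k\<le>j. real (j choose k) * ((fdiff ^^ k) f n * x ^ k * (1 + x) ^ (Suc j - k) +
      (fdiff ^^ Suc k) f n * x ^ Suc k * (1 + x) ^ (Suc j - Suc k)))"
    unfolding Suc.IH sum_distrib_left sum.distrib[symmetric]
    by (intro sum.cong refl) (simp add: Suc_diff_le funpow_swap1 algebra_simps)
  also have "\<dots> = (\<Sum>k\<le>Suc j. real (Suc j choose k) *
      ((fdiff ^^ k) f n * x ^ k * (1 + x) ^ (Suc j - k)))"
    by (rule sum_choose_Suc[symmetric])
  finally show ?case .
qed

section \<open>Asymptotics of forward differences\<close>
lemma coeff_pcompose_shift:
  fixes p :: "real poly"
  assumes "degree p \<le> m"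
  shows "coeff (pcompose p [:1, 1:]) m = coeff p m"
proof (cases "degree p = m")
  case True
  then show ?thesis using lead_coeff_comp[of "[:1, 1:]" p] by (simp add: degree_pcompose)
next
  case False
  with assms show ?thesis by (simp add: coeff_eq_0 degree_pcompose)
qed

lemma degree_coeff_forward_difference:
  fixes p :: "real poly"
  assumes "degree p \<le> Suc m"
  shows "degree (pcompose p [:1, 1:] - p) \<le> m"
    and "coeff (pcompose p [:1, 1:] - p) m = real (Suc m) * coeff p (Suc m)"
proof -
  have "coeff (pcompose p [:1, 1:] - p) i = 0" if "i > m" for i
    using assms that by (cases "i = Suc m") (auto simp: coeff_pcompose_shift coeff_eq_0)
  then show "degree (pcompose p [:1, 1:] - p) \<le> m"
    by (intro degree_le) auto
  show "coeff (pcompose p [:1, 1:] - p) m = real (Suc m) * coeff p (Suc m)"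
    using assms
  proof (induction m arbitrary: p)
    case 0
    obtain a q where p: "p = pCons a q" by (cases p)
    with 0 have "degree q = 0" by (cases "q = 0") auto
    then obtain b where "q = [:b:]" by (rule degree_eq_zeroE)
    with p show ?case by (simp add: pcompose_pCons)
  next
    case (Suc m)
    obtain a q where p: "p = pCons a q" by (cases p)
    with Suc.prems have q: "degree q \<le> Suc m" by (cases "q = 0") auto
    have "pcompose p [:1, 1:] - p = pCons 0 (pcompose q [:1, 1:] - q) + pcompose q [:1, 1:]"
      by (simp add: p pcompose_pCons)
    then show ?case using Suc.IH[OF q] coeff_pcompose_shift[OF q] 
      by (simp add: p algebra_simps del: of_nat_Suc) (simp add: algebra_simps)
  qed
qed

text \<open>
  The polynomial \<open>p\<close> may have degree below \<open>l\<close>, in which case the coefficient in question is \<open>0\<close>.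
  Speaking of \<open>coeff p l\<close> instead of the leading coefficient spares this case distinction.
\<close>
lemma funpow_fdiff_poly:
  fixes p :: "real poly"
  assumes "degree p \<le> l" "k \<le> l"
  obtains q where "(fdiff ^^ k) (\<lambda>n. poly p (real n)) = (\<lambda>n. poly q (real n))"
    "degree q \<le> l - k" "coeff q (l - k) = fact l / fact (l - k) * coeff p l"
proof -
  have "\<exists>q. (fdiff ^^ k) (\<lambda>n. poly p (real n)) = (\<lambda>n. poly q (real n)) \<and>
    degree q \<le> l - k \<and> coeff q (l - k) = fact l / fact (l - k) * coeff p l"
    using assms(2)
  proof (induction k)
    case 0
    then show ?case using assms(1) by auto
  next
    case (Suc k)
    then obtain q where q: "(fdiff ^^ k) (\<lambda>n. poly p (real n)) = (\<lambda>n. poly q (real n))"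
      "degree q \<le> l - k" "coeff q (l - k) = fact l / fact (l - k) * coeff p l" by auto
    have lk: "l - k = Suc (l - Suc k)" using Suc.prems by simp
    have "(fdiff ^^ Suc k) (\<lambda>n. poly p (real n)) = (\<lambda>n. poly (pcompose q [:1, 1:] - q) (real n))"
      by (auto simp: q(1) fdiff_def poly_pcompose)
    then show ?case
      using q degree_coeff_forward_difference[of q "l - Suc k"] unfolding lk
      by (intro exI[of _ "pcompose q [:1, 1:] - q"]) (simp del: of_nat_Suc)
  qed
  then show ?thesis using that by blast
qed

lemma tendsto_poly_div_power:
  fixes q :: "real poly"
  assumes "degree q \<le> m"
  shows "(\<lambda>n. poly q (real n) / real n ^ m) \<longlonglongrightarrow> coeff q m"
proof -
  have 1: "(\<lambda>n. real n ^ i / real n ^ m) \<longlonglongrightarrow> (if i = m then 1 else 0)" if "i \<le> m" for i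
  proof (cases "i = m")
    case True
    have "\<forall>\<^sub>F n in sequentially. real n ^ i / real n ^ m = 1"
      using eventually_gt_at_top[of 0] by eventually_elim (simp add: True)
    then show ?thesis using True by (simp add: tendsto_eventually)
  next
    case False
    with that have "i < m" by simp
    then have "(\<lambda>n. real n ^ i / real n ^ m) \<longlonglongrightarrow> 0"
      by real_asymp
    then show ?thesis using False by simp
  qed
  have "(\<lambda>n. \<Sum>i\<le>m. coeff q i * (real n ^ i / real n ^ m)) \<longlonglongrightarrow>
      (\<Sum>i\<le>m. coeff q i * (if i = m then 1 else 0))"
    by (intro tendsto_sum tendsto_mult tendsto_const 1) auto
  moreover have "poly q x = (\<Sum>i\<le>m. coeff q i * x ^ i)" for x
    unfolding poly_altdef using assms by (intro sum.mono_neutral_left) (auto simp: coeff_eq_0)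
  moreover have "(\<Sum>i\<le>m. coeff q i * (if i = m then 1 else 0)) = coeff q m"
    by (simp add: if_distrib cong: if_cong)
  ultimately show ?thesis by (simp add: sum_divide_distrib)
qed

text \<open>
  Unlike for polynomials, differencing need not lower the order of an error term. This is why the
  expansion of \<open>f\<close> has to reach down to \<open>n^(l-d)\<close> for differences of order \<open>d\<close>.
\<close>
lemma fdiff_smallo:
  assumes "e \<in> o(\<lambda>n. real n ^ r)"
  shows "fdiff e \<in> o(\<lambda>n. real n ^ r)"
proof -
  have "(\<lambda>n. e (Suc n)) \<in> o(\<lambda>n. real (Suc n) ^ r)"
    using assms filterlim_Suc by (rule landau_o.small.compose)
  also have "(\<lambda>n. real (Suc n) ^ r) \<in> O(\<lambda>n. real n ^ r)"
    by real_asymp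
  finally show ?thesis
    unfolding fdiff_def[abs_def] using assms by (intro sum_in_smallo)
qed

lemma funpow_fdiff_add:
  "(fdiff ^^ k) (\<lambda>n. f n + g n) = (\<lambda>n. (fdiff ^^ k) f n + (fdiff ^^ k) g n)"
  by (induction k) (auto simp: fdiff_def)

lemma funpow_fdiff_tendsto:
  assumes p: "degree p \<le> l" and e: "e \<in> o(\<lambda>n. real n ^ (l - d))"
    and "k \<le> d" "d \<le> l"
  shows "(\<lambda>n. (fdiff ^^ k) (\<lambda>n. poly p (real n) + e n) n / real n ^ (l - k))
    \<longlonglongrightarrow> fact l / fact (l - k) * coeff p l"
proof -
  obtain q where q: "(fdiff ^^ k) (\<lambda>n. poly p (real n)) = (\<lambda>n. poly q (real n))"
    "degree q \<le> l - k" "coeff q (l - k) = fact l / fact (l - k) * coeff p l"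
    using funpow_fdiff_poly[OF p, of k] assms(3,4) by auto
  have "(fdiff ^^ k) e \<in> o(\<lambda>n. real n ^ (l - d))"
    by (induction k) (simp_all add: e fdiff_smallo)
  also have "(\<lambda>n. real n ^ (l - d)) \<in> O(\<lambda>n. real n ^ (l - k))"
  proof (rule bigoI)
    show "\<forall>\<^sub>F n in sequentially. norm (real n ^ (l - d)) \<le> 1 * norm (real n ^ (l - k))"
      using eventually_ge_at_top[of 1]
      by eventually_elim (use assms(3) in \<open>auto intro!: power_increasing\<close>)
  qed
  finally have "(\<lambda>n. (fdiff ^^ k) e n / real n ^ (l - k)) \<longlonglongrightarrow> 0"
    by (rule smalloD_tendsto)
  with tendsto_poly_div_power[OF q(2)]
  have "(\<lambda>n. poly q (real n) / real n ^ (l - k) + (fdiff ^^ k) e n / real n ^ (l - k))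
      \<longlonglongrightarrow> coeff q (l - k) + 0"
    by (rule tendsto_add)
  then show ?thesis
    by (simp add: funpow_fdiff_add q add_divide_distrib)
qed

section \<open>The rescaled Jensen polynomials\<close>

text \<open>
  The substitution makes \<open>x / (1 + x) = n / y\<close>, so the \<open>k\<close>-th difference gets the weight \<open>n^k\<close>, which
  compensates for its order of growth \<open>n^(l-k)\<close>.
\<close>
lemma jensen_poly_rescaled:
  assumes "y < 0" "0 < n" "j \<le> l"
  shows "poly (jensen_poly f j n) (real n / (y - real n)) = real n ^ l / (y - real n) ^ j *
    (\<Sum>k\<le>j. real (j choose k) * ((fdiff ^^ k) f n / real n ^ (l - k)) * y ^ (j - k))"
  unfolding jensen_poly_fdiff sum_distrib_left
proof (rule sum.cong)
  fix k assume "k \<in> {..j}"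
  then have k: "k \<le> j" "k \<le> l" using assms by auto
  define s where "s = y - real n"
  have s: "s \<noteq> 0" "1 + real n / s = y / s" using assms by (auto simp: s_def field_simps)
  have "s ^ j = s ^ k * s ^ (j - k)" "real n ^ l = real n ^ k * real n ^ (l - k)"
    using k by (simp_all flip: power_add)
  then show "real (j choose k) * ((fdiff ^^ k) f n * (real n / (y - real n)) ^ k *
      (1 + real n / (y - real n)) ^ (j - k)) = real n ^ l / (y - real n) ^ j *
      (real (j choose k) * ((fdiff ^^ k) f n / real n ^ (l - k)) * y ^ (j - k))"
    using s assms by (simp add: s(2) power_divide flip: s_def)
qed simp

lemma degree_jensen_poly_le: "degree (jensen_poly f j n) \<le> j"
  unfolding jensen_poly_def
  by (intro degree_sum_le) (auto intro: order_trans[OF degree_monom_le])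

theorem theorem3p1:
  fixes d l :: nat and f :: "nat \<Rightarrow> real" and c :: "nat \<Rightarrow> real"
  assumes "1 \<le> d" and "d \<le> l"
    and "(\<lambda>n. f n - (\<Sum>i=l-d..l. c i * real n ^ i)) \<in> o(\<lambda>n. real n ^ (l - d))"
    and "c l \<noteq> 0"
  shows "\<forall>j. 1 \<le> j \<and> j \<le> d \<longrightarrow> finite {n. \<not> turan_ineq f j n}"
proof (intro allI impI)
  fix j assume "1 \<le> j \<and> j \<le> d"
  then have j: "j \<le> d" "j \<le> l" using assms by auto
  define p where "p = (\<Sum>i=l-d..l. monom (c i) i)"
  define e where "e n = f n - poly p (real n)" for n
  have "degree p \<le> l"
    unfolding p_def by (intro degree_sum_le) (auto intro: order_trans[OF degree_monom_le])
  moreover have "coeff p l = c l"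
    by (simp add: p_def coeff_sum)
  moreover have "e \<in> o(\<lambda>n. real n ^ (l - d))"
    using assms(3) by (simp add: e_def[abs_def] p_def poly_sum poly_monom)
  moreover have "f = (\<lambda>n. poly p (real n) + e n)"
    by (simp add: e_def)
  ultimately have lim: "(\<lambda>n. (fdiff ^^ k) f n / real n ^ (l - k)) \<longlonglongrightarrow> fact l / fact (l - k) * c l"
    if "k \<le> d" for k
    using funpow_fdiff_tendsto[of p l e d k] that assms(2) by metis

  define F where "F n y =
    (\<Sum>k\<le>j. real (j choose k) * ((fdiff ^^ k) f n / real n ^ (l - k)) * y ^ (j - k))" for n y
  define R where "R = smult (c l) (laguerre_reflected l j)"
  have deg_R: "degree R = j" and "R \<noteq> 0"
  proof -
    show "degree R = j" using assms(4) by (simp add: R_def degree_laguerre_reflected)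
    show "R \<noteq> 0" using assms(4) by (simp add: R_def laguerre_reflected_nonzero)
  qed
  have "(\<lambda>n. F n y) \<longlonglongrightarrow> poly R y" for y
  proof -
    have "(\<lambda>n. F n y) \<longlonglongrightarrow>
        (\<Sum>k\<le>j. real (j choose k) * (fact l / fact (l - k) * c l) * y ^ (j - k))"
      unfolding F_def using j by (intro tendsto_intros lim) auto
    then show ?thesis
      by (simp add: R_def poly_laguerre_reflected sum_distrib_left mult_ac)
  qed
  moreover have "continuous_on UNIV (F n)" for n
    unfolding F_def by (intro continuous_intros)
  moreover obtain A where A: "finite A" "card A = j" "\<And>a. a \<in> A \<Longrightarrow> a < 0"
      "\<And>a. a \<in> A \<Longrightarrow> poly R a = 0"
    using laguerre_reflected_roots[OF j(2)] by (metis R_def poly_smult mult_zero_right)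
  moreover have "poly (pderiv R) a \<noteq> 0" if "a \<in> A" for a
    using pderiv_nonzero_if_card_roots[of R A a] A that deg_R \<open>R \<noteq> 0\<close> by simp
  ultimately have "\<forall>\<^sub>F n in sequentially.
      \<exists>B. finite B \<and> card B = j \<and> (\<forall>b\<in>B. b < 0 \<and> F n b = 0)"
    using eventually_many_negative_roots[of F R A] by auto
  moreover have "\<forall>\<^sub>F n in sequentially. f n / real n ^ l \<noteq> 0"
    using tendsto_imp_eventually_ne[OF lim[of 0], of 0] assms(4) by simp
  ultimately have "\<forall>\<^sub>F n in sequentially. turan_ineq f j n"
    using eventually_gt_at_top[of 0]
  proof eventually_elim
    case (elim n)
    then obtain B where B: "finite B" "card B = j" "\<And>b. b \<in> B \<Longrightarrow> b < 0" "\<And>b. b \<in> B \<Longrightarrow> F n b = 0"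
      by blast
    let ?J = "jensen_poly f j n" and ?x = "\<lambda>y. real n / (y - real n)"
    have "poly ?J 0 = (\<Sum>i\<le>j. if i = 0 then f n else 0)"
      unfolding poly_jensen_poly by (intro sum.cong) (auto simp: power_0_left)
    with elim have "?J \<noteq> 0" by auto
    moreover have "inj_on ?x B"
      using elim(3) by (intro inj_onI) simp
    then have "degree ?J \<le> card (?x ` B)"
      using degree_jensen_poly_le[of f j n] B(2) by (simp add: card_image)
    moreover have "poly ?J x = 0" if "x \<in> ?x ` B" for x
      using that B jensen_poly_rescaled[of _ n j l f] elim(3) j by (auto simp: F_def)
    ultimately show ?case
      unfolding turan_ineq_def using B(1) by (intro hyperbolicI_card_roots[of _ "?x ` B"]) auto
  qed
  then show "finite {n. \<not> turan_ineq f j n}"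
    by (simp add: cofinite_eq_sequentially[symmetric] eventually_cofinite)
qed

end
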